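(* Let $q>1$, $\mathcal{Q}=\{q^n:n\in\mathbb{N}_0\}$, $a\in\mathcal{Q}$ and $f:[a,+\infty[\rightarrow\mathbb{R}$. If $$\lim_{T\to+\infty}\inf_{T'\ge T}\int_a^{T'}f(t)\,D_q[\eta](t)\,d_qt=0$$ for all $\eta:[a,+\infty[\rightarrow\mathbb{R}$ such that $\eta(a)=0$, then there is $c\in\mathbb{R}$ such that $f(t)=c$ for all $t\in[a,+\infty[$.
   Context: Here $q>1$ is a fixed real, $\mathcal{Q}=\{q^n:n\in\mathbb{N}_0\}$, and intervals are $q$-intervals: $[a,+\infty[=\{t\in\mathcal{Q}:t\ge a\}$. The Jackson $q$-difference operator is $D_q[f](t)=\frac{f(qt)-f(t)}{(q-1)t}$. For $b=aq^n$ ($n\in\mathbb{N}_0$), $\int_a^bf(t)\,d_qt=a(q-1)\sum_{k=0}^{n-1}q^kf(aq^k)$. In $\lim_{T\to+\infty}\inf_{T'\ge T}$, $T$ and $T'$ range over elements of $\mathcal{Q}$ with $T'\ge T>a$, and infima and limits are taken in $\overline{\mathbb{R}}=\mathbb{R}\cup\{\pm\infty\}$. *)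

theory Defs
  imports "HOL-Analysis.Analysis"
begin

definition q_set :: "real \<Rightarrow> real set" where
  "q_set q = {q ^ n | n :: nat. True}"

definition q_atLeast :: "real \<Rightarrow> real \<Rightarrow> real set" where
  "q_atLeast q a = {t \<in> q_set q. a \<le> t}"

definition q_deriv :: "real \<Rightarrow> (real \<Rightarrow> real) \<Rightarrow> real \<Rightarrow> real" where
  "q_deriv q f t = (f (q * t) - f t) / ((q - 1) * t)"

text \<open>
  The integral is only meaningful when the upper limit is \<open>b = a * q ^ n\<close> for some
  natural number \<open>n\<close>; for \<open>q > 1\<close> and \<open>a > 0\<close> this \<open>n\<close> is unique, see
  \<open>q_integral_power\<close> below.
\<close>

definition q_integral :: "real \<Rightarrow> real \<Rightarrow> real \<Rightarrow> (real \<Rightarrow> real) \<Rightarrow> real" where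
  "q_integral q a b f =
     (let n = (THE n. b = a * q ^ n) in a * (q - 1) * (\<Sum>k<n. q ^ k * f (a * q ^ k)))"

lemma q_integral_power:
  assumes "q > 1" and "a > 0"
  shows "q_integral q a (a * q ^ n) f = a * (q - 1) * (\<Sum>k<n. q ^ k * f (a * q ^ k))"
proof -
  have "(THE m. a * q ^ n = a * q ^ m) = n"
    using assms by (intro the_equality) simp_all
  then show ?thesis
    by (simp add: q_integral_def)
qed

text \<open>
  The filter of \<open>T\<close> tending to infinity with \<open>T\<close> ranging over the elements of
  \<open>q_set q\<close> that are greater than \<open>a\<close>.
\<close>

definition q_at_top :: "real \<Rightarrow> real \<Rightarrow> real filter" where
  "q_at_top q a = inf at_top (principal {T \<in> q_set q. a < T})"

lemma q_at_top_neq_bot: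
  assumes "q > 1"
  shows "q_at_top q a \<noteq> bot"
proof
  assume "q_at_top q a = bot"
  then have "eventually (\<lambda>T. False) (inf at_top (principal {T \<in> q_set q. a < T}))"
    unfolding q_at_top_def by simp
  then have "eventually (\<lambda>T. T \<in> {T \<in> q_set q. a < T} \<longrightarrow> False) at_top"
    unfolding eventually_inf_principal .
  then obtain N where N: "\<And>T. T \<ge> N \<Longrightarrow> \<not> (T \<in> q_set q \<and> a < T)"
    unfolding eventually_at_top_linorder by blast
  obtain n where n: "max N a < q ^ n"
    using real_arch_pow[OF assms] by blast
  have "q ^ n \<in> q_set q"
    unfolding q_set_def by blast
  with N[of "q ^ n"] n show False
    by simp
qed

end

theory Submission
  imports Defs
begin

text \<open>
  Against \<open>D\<^sub>q[\<eta>]\<close> the Jackson weights cancel, so that the integral is the Stieltjes sum of \<open>f\<close>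
  with respect to the increments of \<open>\<eta>\<close> along \<open>a, a q, a q\<^sup>2, \<dots>\<close>
  (\<open>q_integral_mult_q_deriv\<close>). The test functions \<open>\<eta>\<close> are constrained at \<open>a\<close> but not at
  infinity, so \<open>\<eta>\<close> may be a unit step with its only jump between \<open>s\<close> and \<open>q s\<close>. For this step
  the integral equals \<open>f s\<close> as soon as the upper limit exceeds \<open>s\<close>
  (\<open>q_integral_mult_q_deriv_step\<close>); hence the limit in the hypothesis is \<open>f s\<close>, and \<open>f s = 0\<close>.
  The function \<open>f\<close> is therefore constant with value \<open>0\<close>.
\<close>

lemma q_set_pos: "q > 1 \<Longrightarrow> a \<in> q_set q \<Longrightarrow> a > 0"
  by (auto simp: q_set_def)

lemma q_atLeast_obtain_power:
  assumes "q > 1" and "a \<in> q_set q" and "t \<in> q_atLeast q a"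
  obtains n where "t = a * q ^ n"
proof -
  obtain i j where "a = q ^ i" "t = q ^ j" "q ^ i \<le> q ^ j"
    using assms unfolding q_atLeast_def q_set_def by auto
  moreover from this have "i \<le> j"
    using assms(1) by simp
  ultimately have "t = a * q ^ (j - i)"
    by (simp flip: power_add)
  then show ?thesis
    by (rule that)
qed

text \<open>
  The weight \<open>(q - 1) a q\<^sup>k\<close> of the point \<open>a q\<^sup>k\<close> in the integral is exactly the denominator of
  \<open>D\<^sub>q[\<eta>]\<close> there.
\<close>

lemma q_integral_mult_q_deriv:
  assumes "q > 1" and "a > 0"
  shows "q_integral q a (a * q ^ n) (\<lambda>t. f t * q_deriv q \<eta> t) =
           (\<Sum>k<n. f (a * q ^ k) * (\<eta> (a * q ^ Suc k) - \<eta> (a * q ^ k)))"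
proof -
  have "a * (q - 1) * (q ^ k * (f (a * q ^ k) * q_deriv q \<eta> (a * q ^ k))) =
          f (a * q ^ k) * (\<eta> (a * q ^ Suc k) - \<eta> (a * q ^ k))" for k
    using assms by (simp add: q_deriv_def field_simps)
  then show ?thesis
    unfolding q_integral_power[OF assms] sum_distrib_left by (intro sum.cong refl)
qed

text \<open>
  The \<open>q\<close>-derivative of a unit step acts as a point mass: among the increments between consecutive
  points only the one starting at the jump point is nonzero.
\<close>

lemma q_integral_mult_q_deriv_step:
  assumes "q > 1" and "a > 0" and "m < n"
  shows "q_integral q a (a * q ^ n) (\<lambda>t. f t * q_deriv q (\<lambda>t. of_bool (a * q ^ m < t)) t) =
           f (a * q ^ m)"
proof -
  have step: "a * q ^ m < a * q ^ k \<longleftrightarrow> m < k" for k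
    using assms by simp
  have "q_integral q a (a * q ^ n) (\<lambda>t. f t * q_deriv q (\<lambda>t. of_bool (a * q ^ m < t)) t) =
          (\<Sum>k<n. if k = m then f (a * q ^ m) else 0)"
    unfolding q_integral_mult_q_deriv[OF assms(1,2)] step
    by (intro sum.cong) auto
  also have "\<dots> = f (a * q ^ m)"
    using assms(3) by simp
  finally show ?thesis .
qed

theorem lemma5:
  fixes q a :: real and f :: "real \<Rightarrow> real"
  assumes "q > 1" and "a \<in> q_set q"
    and "\<And>\<eta> :: real \<Rightarrow> real. \<eta> a = 0 \<Longrightarrow>
           ((\<lambda>T. INF T' \<in> q_atLeast q T.
                ereal (q_integral q a T' (\<lambda>t. f t * q_deriv q \<eta> t))) \<longlongrightarrow> 0) (q_at_top q a)"
  shows "\<exists>c :: real. \<forall>t \<in> q_atLeast q a. f t = c"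
proof (intro exI ballI)
  fix s assume "s \<in> q_atLeast q a"
  then obtain m where s: "s = a * q ^ m"
    using q_atLeast_obtain_power assms(1,2) by blast
  have a: "a > 0"
    using q_set_pos assms(1,2) by blast
  define \<eta> :: "real \<Rightarrow> real" where "\<eta> = (\<lambda>t. of_bool (a * q ^ m < t))"
  let ?I = "\<lambda>T'. ereal (q_integral q a T' (\<lambda>t. f t * q_deriv q \<eta> t))"

  have I: "?I T' = ereal (f s)" if T: "s < T" "a < T" "T' \<in> q_atLeast q T" for T T'
  proof -
    have "T' \<in> q_atLeast q a"
      using T by (auto simp: q_atLeast_def)
    then obtain n where n: "T' = a * q ^ n"
      using q_atLeast_obtain_power assms(1,2) by blast
    have "a * q ^ m < a * q ^ n"
      using T n s by (auto simp: q_atLeast_def)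
    then have "m < n"
      using a assms(1) by simp
    then show ?thesis
      unfolding n s \<eta>_def using q_integral_mult_q_deriv_step[OF assms(1) a] by simp
  qed
  have inf_eq: "(INF T' \<in> q_atLeast q T. ?I T') = ereal (f s)"
    if T: "s < T" "a < T" "T \<in> q_set q" for T
  proof -
    \<comment> \<open>An infimum over the empty set would be \<open>\<infinity>\<close>.\<close>
    have "q_atLeast q T \<noteq> {}"
      using T(3) by (auto simp: q_atLeast_def)
    then show ?thesis
      using I[OF T(1,2)] by simp
  qed
  have "eventually (\<lambda>T. (INF T' \<in> q_atLeast q T. ?I T') = ereal (f s)) (q_at_top q a)"
    unfolding q_at_top_def eventually_inf_principal
    using eventually_gt_at_top[of s] by eventually_elim (auto intro: inf_eq)
  then have "((\<lambda>T. INF T' \<in> q_atLeast q T. ?I T') \<longlongrightarrow> ereal (f s)) (q_at_top q a)"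
    by (rule tendsto_eventually)
  moreover have "((\<lambda>T. INF T' \<in> q_atLeast q T. ?I T') \<longlongrightarrow> 0) (q_at_top q a)"
    by (rule assms(3)) (use a assms(1) in \<open>simp add: \<eta>_def not_less\<close>)
  ultimately have "ereal (f s) = 0"
    using tendsto_unique q_at_top_neq_bot[OF assms(1)] by blast
  then show "f s = 0"
    by simp
qed

end
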